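(* Every regular countably compact space with countable $\pi$-character and no uncountable free sequences has a point-countable $\pi$-base.
   Context: Regular spaces are assumed $T_1$. A $\pi$-base for $X$ is a family $\mathcal R$ of nonempty open sets such that every nonempty open set contains a member of $\mathcal R$. A local $\pi$-base for $p\in X$ is a family $\mathcal R$ of nonempty open subsets of $X$ such that every open set containing $p$ contains some $R\in\mathcal R$; $X$ has countable $\pi$-character if every point has a countable local $\pi$-base. A family of sets is point-countable if every point belongs to at most countably many of its members. A sequence $\{p_\alpha:\alpha<\mu\}\subseteq X$ is free if $\overline{\{p_\alpha:\alpha<\delta\}}\cap\overline{\{p_\alpha:\delta\le\alpha<\mu\}}=\emptyset$ for every $\delta<\mu$. *)

theory Defs
  imports "HOL-Analysis.Analysis"
begin

definition countably_compact_space :: "'a topology \<Rightarrow> bool" where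
  "countably_compact_space X \<longleftrightarrow>
     (\<forall>\<U>. countable \<U> \<and> (\<forall>U\<in>\<U>. openin X U) \<and> topspace X \<subseteq> \<Union>\<U>
        \<longrightarrow> (\<exists>\<F>. finite \<F> \<and> \<F> \<subseteq> \<U> \<and> topspace X \<subseteq> \<Union>\<F>))"

lemma countably_compact_space_euclidean:
  "countably_compact_space (euclidean :: 'a::topological_space topology)
     \<longleftrightarrow> countably_compact (UNIV :: 'a set)"
  unfolding countably_compact_space_def countably_compact_def by (simp; meson)

definition pi_base :: "'a topology \<Rightarrow> 'a set set \<Rightarrow> bool" where
  "pi_base X \<R> \<longleftrightarrow>
     (\<forall>R\<in>\<R>. openin X R \<and> R \<noteq> {}) \<and>
     (\<forall>U. openin X U \<and> U \<noteq> {} \<longrightarrow> (\<exists>R\<in>\<R>. R \<subseteq> U))"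

text \<open>The members of a local \<open>\<pi>\<close>-base at \<open>p\<close> need not contain \<open>p\<close>.\<close>

definition local_pi_base :: "'a topology \<Rightarrow> 'a \<Rightarrow> 'a set set \<Rightarrow> bool" where
  "local_pi_base X p \<R> \<longleftrightarrow>
     (\<forall>R\<in>\<R>. openin X R \<and> R \<noteq> {}) \<and>
     (\<forall>U. openin X U \<and> p \<in> U \<longrightarrow> (\<exists>R\<in>\<R>. R \<subseteq> U))"

definition countable_pi_character :: "'a topology \<Rightarrow> bool" where
  "countable_pi_character X \<longleftrightarrow>
     (\<forall>p\<in>topspace X. \<exists>\<R>. countable \<R> \<and> local_pi_base X p \<R>)"

definition point_countable_in :: "'a topology \<Rightarrow> 'a set set \<Rightarrow> bool" where
  "point_countable_in X \<R> \<longleftrightarrow> (\<forall>x\<in>topspace X. countable {R \<in> \<R>. x \<in> R})"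

text \<open>
  The ordinal \<open>\<mu>\<close> indexing a sequence is represented by a (reflexive) well-order \<open>r\<close>:
  its elements \<open>\<alpha> < \<mu>\<close> are the elements of \<open>Field r\<close>, the \<open>\<alpha> < \<delta>\<close> form \<open>underS r \<delta>\<close>
  and the \<open>\<alpha>\<close> with \<open>\<delta> \<le> \<alpha> < \<mu>\<close> form \<open>above r \<delta>\<close>.
\<close>

definition free_sequence :: "'a topology \<Rightarrow> 'i rel \<Rightarrow> ('i \<Rightarrow> 'a) \<Rightarrow> bool" where
  "free_sequence X r p \<longleftrightarrow>
     Well_order r \<and> p ` Field r \<subseteq> topspace X \<and>
     (\<forall>\<delta>\<in>Field r. X closure_of (p ` underS r \<delta>) \<inter> X closure_of (p ` above r \<delta>) = {})"

text \<open>
  Indices range over the well-orders on subsets of the type of points. This is no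
  restriction: a free sequence is injective, so by lemma \<open>free_sequence_reindex\<close> below one with
  indices of any other type can be reindexed by points, with the same set of terms and an
  isomorphic index order. Injectivity also makes it immaterial whether ``uncountable'' refers to
  the length or to the set of terms.
\<close>

definition no_uncountable_free_sequences :: "'a topology \<Rightarrow> bool" where
  "no_uncountable_free_sequences X \<longleftrightarrow>
     (\<forall>(r :: 'a rel) (p :: 'a \<Rightarrow> 'a). free_sequence X r p \<longrightarrow> countable (Field r))"

lemma free_sequence_inj_on:
  assumes "free_sequence X r p"
  shows "inj_on p (Field r)"
proof -
  have W: "Well_order r" and T: "p ` Field r \<subseteq> topspace X"
    and F: "\<And>d. d \<in> Field r \<Longrightarrow>
      X closure_of (p ` underS r d) \<inter> X closure_of (p ` above r d) = {}"
    using assms by (auto simp: free_sequence_def)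
  have refl: "Refl r" and tot: "Total r"
    using W by (auto simp: well_order_on_def linear_order_on_def partial_order_on_def
        preorder_on_def)
  have neq: "p a \<noteq> p b" if "a \<in> Field r" "b \<in> Field r" "a \<noteq> b" "(a, b) \<in> r" for a b
  proof -
    have "a \<in> underS r b" "b \<in> above r b"
      using that refl by (auto simp: underS_def above_def refl_on_def)
    moreover have "p ` underS r b \<subseteq> topspace X" "p ` above r b \<subseteq> topspace X"
      using T by (auto simp: underS_def above_def Field_def)
    ultimately have "p a \<in> X closure_of (p ` underS r b)" "p b \<in> X closure_of (p ` above r b)"
      by (meson closure_of_subset image_eqI subsetD)+
    then show ?thesis using F[OF that(2)] by auto
  qed
  show ?thesis
  proof (rule inj_onI, rule ccontr)
    fix a b assume "a \<in> Field r" "b \<in> Field r" "p a = p b" "a \<noteq> b"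
    then show False using tot neq[of a b] neq[of b a] by (auto simp: total_on_def)
  qed
qed

lemma free_sequence_reindex:
  fixes X :: "'a topology" and r :: "'i rel"
  assumes "free_sequence X r p"
  shows "\<exists>r' :: 'a rel. iso r r' p \<and> Field r' = p ` Field r \<and> free_sequence X r' id"
proof -
  have inj: "inj_on p (Field r)" using assms by (rule free_sequence_inj_on)
  have W: "Well_order r" using assms by (simp add: free_sequence_def)
  let ?r = "dir_image r p"
  have F: "Field ?r = p ` Field r" by (rule dir_image_Field)
  have "underS ?r (p d) = p ` underS r d \<and> above ?r (p d) = p ` above r d"
    if "d \<in> Field r" for d
    using that inj unfolding underS_def above_def dir_image_def
    by (auto simp: inj_on_def Field_def) blast+
  then have "free_sequence X ?r id"
    using assms Well_order_dir_image[OF W inj] F by (auto simp: free_sequence_def)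
  then show ?thesis using F dir_image_iso[OF W inj] by blast
qed

end

theory Submission
  imports Defs
begin

text \<open>
  Well-order the nonempty open sets, attach to each such \<open>U\<close> a nonempty open \<open>V U\<close> whose closure
  lies in \<open>U\<close>, and to each finite set \<open>F\<close> of open sets with \<open>V F = \<Inter>{V U | U \<in> F} \<noteq> {}\<close> a point
  \<open>p F \<in> V F\<close> and a countable local \<open>\<pi>\<close>-base \<open>B F\<close> at \<open>p F\<close> consisting of subsets of \<open>V F\<close>.
  Recursively, select \<open>U\<close> if it contains no member of \<open>B F\<close> for any finite set \<open>F\<close> of previously
  selected sets. The union of all \<open>B F\<close>, for \<open>F\<close> a finite set of selected sets, is then a
  \<open>\<pi>\<close>-base, and it is point-countable as soon as the family of all selected \<open>V U\<close> is.

  If \<open>x \<in> V U\<close> for \<open>\<omega>\<^sub>1\<close> many selected \<open>U\<close>, then for each such \<open>U\<close> take a cluster point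
  \<open>y U\<close> of the points \<open>p F\<close>, where \<open>F\<close> runs through the directed set of finite sets of such
  indices up to \<open>U\<close>. It lies in the closure of \<open>V W\<close> for each earlier \<open>W\<close>, and outside of
  each later \<open>W\<close>, because \<open>W\<close> contains none of the \<open>p F\<close> with \<open>F\<close> before \<open>W\<close>. So the \<open>y U\<close>
  form an uncountable free sequence.
\<close>

text \<open>Otherwise the complements of these closures, one for each of the countably many finite
  \<open>G\<close>, cover the space. If finitely many \<open>G\<close> suffice, let \<open>F\<close>
  be their union: \<open>p F\<close> lies in each of the corresponding closures, so it is not
  covered.\<close>

lemma countably_compact_space_cluster_point:
  assumes cc: "countably_compact_space X" and C: "countable C"
    and p: "\<And>F. finite F \<Longrightarrow> F \<subseteq> C \<Longrightarrow> p F \<in> topspace X"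
  shows "\<exists>y\<in>topspace X. \<forall>G. finite G \<longrightarrow> G \<subseteq> C \<longrightarrow>
    y \<in> X closure_of (p ` {F. finite F \<and> G \<subseteq> F \<and> F \<subseteq> C})"
proof (rule ccontr)
  assume no: "\<not> ?thesis"
  define K where "K G = X closure_of (p ` {F. finite F \<and> G \<subseteq> F \<and> F \<subseteq> C})" for G
  define \<U> where "\<U> = (\<lambda>G. topspace X - K G) ` {G. finite G \<and> G \<subseteq> C}"
  have "countable \<U>"
    unfolding \<U>_def using countable_Collect_finite_subset[OF C] by (intro countable_image)
  moreover have "\<forall>U\<in>\<U>. openin X U"
    by (auto simp: \<U>_def K_def)
  moreover have "topspace X \<subseteq> \<Union>\<U>"
    using no by (auto simp: \<U>_def K_def)
  ultimately obtain \<F> where F: "finite \<F>" "\<F> \<subseteq> \<U>" "topspace X \<subseteq> \<Union>\<F>"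
    using cc unfolding countably_compact_space_def by meson
  from finite_subset_image[OF F(1) F(2)[unfolded \<U>_def]] obtain \<G>
    where G: "finite \<G>" "\<G> \<subseteq> {G. finite G \<and> G \<subseteq> C}" "\<F> = (\<lambda>G. topspace X - K G) ` \<G>"
    by auto
  have fin: "finite (\<Union>\<G>)" "\<Union>\<G> \<subseteq> C"
    using G by auto
  have "p (\<Union>\<G>) \<in> K G" if "G \<in> \<G>" for G
  proof -
    have "p ` {F. finite F \<and> G \<subseteq> F \<and> F \<subseteq> C} \<subseteq> K G"
      unfolding K_def using p by (intro closure_of_subset) auto
    then show ?thesis using fin that by blast
  qed
  then show False
    using F(3) G(3) p[OF fin] by auto
qed

lemma countable_if_no_uncountable_free_sequences:
  fixes X :: "'a topology" and r :: "'i rel"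
  assumes cc: "countably_compact_space X" and nf: "no_uncountable_free_sequences X"
    and r: "Well_order r" and A: "A \<subseteq> Field r"
    and U: "\<And>a. a \<in> A \<Longrightarrow> openin X (U a)"
    and V: "\<And>a. a \<in> A \<Longrightarrow> X closure_of V a \<subseteq> U a"
    and p: "\<And>F. finite F \<Longrightarrow> F \<subseteq> A \<Longrightarrow> p F \<in> topspace X \<inter> \<Inter>(V ` F)"
    and pU: "\<And>a F. a \<in> A \<Longrightarrow> finite F \<Longrightarrow> F \<subseteq> A \<inter> underS r a \<Longrightarrow> p F \<notin> U a"
  shows "countable A"
proof (rule ccontr)
  assume unc: "uncountable A"
  interpret r: wo_rel r using r by (simp add: wo_rel_def)
  \<comment> \<open>Cluster points are available only for countable index sets. \<open>A'\<close> is
    an initial segment of \<open>A\<close> with countable initial segments; if it is proper, it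
    contains all predecessors in \<open>A\<close> of the least missing element, and these are
    uncountably many.\<close>
  define A' where "A' = {a\<in>A. countable (A \<inter> under r a)}"
  have A'_unc: "uncountable A'"
  proof (cases "A' = A")
    case False
    then have ne: "A - A' \<noteq> {}" by (auto simp: A'_def)
    let ?m = "r.minim (A - A')"
    have sub: "A - A' \<subseteq> Field r" using A by auto
    have m: "?m \<in> A" "?m \<notin> A'" using r.minim_in[OF sub ne] by auto
    have "underS r ?m \<inter> (A - A') = {}"
      using r.minim_least[OF sub] r.ANTISYM by (auto simp: underS_def antisym_def)
    then have "A \<inter> under r ?m \<subseteq> insert ?m A'"
      by (auto simp: underS_def under_def)
    then show ?thesis using m by (auto simp: A'_def dest: countable_subset)
  qed (use unc in simp)
  define C where "C a = A' \<inter> under r a" for a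
  have "\<forall>a\<in>A'. \<exists>y. y \<in> topspace X \<and> (\<forall>G. finite G \<longrightarrow> G \<subseteq> C a \<longrightarrow>
      y \<in> X closure_of (p ` {F. finite F \<and> G \<subseteq> F \<and> F \<subseteq> C a}))"
  proof
    fix a assume "a \<in> A'"
    then have "countable (C a)"
      by (auto simp: C_def A'_def intro: countable_subset[rotated])
    moreover have "p F \<in> topspace X" if "finite F" "F \<subseteq> C a" for F
      using p[of F] that by (auto simp: C_def A'_def)
    ultimately show "\<exists>y. y \<in> topspace X \<and> (\<forall>G. finite G \<longrightarrow> G \<subseteq> C a \<longrightarrow>
        y \<in> X closure_of (p ` {F. finite F \<and> G \<subseteq> F \<and> F \<subseteq> C a}))"
      using countably_compact_space_cluster_point[OF cc, of "C a" p] by blast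
  qed
  from bchoice[OF this] obtain y where yX: "\<And>a. a \<in> A' \<Longrightarrow> y a \<in> topspace X"
    and y: "\<And>a G. a \<in> A' \<Longrightarrow> finite G \<Longrightarrow> G \<subseteq> C a \<Longrightarrow>
      y a \<in> X closure_of (p ` {F. finite F \<and> G \<subseteq> F \<and> F \<subseteq> C a})"
    by blast
  \<comment> \<open>With \<open>G = {d}\<close>, every \<open>F\<close> in the tail contains
    \<open>d\<close>, hence \<open>p F\<close> lies in \<open>V d\<close>.\<close>
  have y_in: "y a \<in> X closure_of V d" if "a \<in> A'" "d \<in> A'" "(d, a) \<in> r" for a d
  proof -
    have C: "C a \<subseteq> A" "d \<in> C a"
      using that by (auto simp: C_def A'_def under_def)
    have "p F \<in> V d" if "finite F" "{d} \<subseteq> F" "F \<subseteq> C a" for F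
      using p[of F] that C by auto
    then have "p ` {F. finite F \<and> {d} \<subseteq> F \<and> F \<subseteq> C a} \<subseteq> V d"
      by auto
    from closure_of_mono[OF this, of X] show ?thesis
      using y[of a "{d}"] C that by simp blast
  qed
  \<comment> \<open>If the open set \<open>U d\<close> contained \<open>y a\<close>, it would
    contain some \<open>p F\<close> with all indices in \<open>F\<close> at most \<open>a\<close>,
    so before \<open>d\<close>, against \<open>pU\<close>.\<close>
  have y_out: "y a \<notin> U d" if a: "a \<in> A'" and d: "d \<in> A'" and ad: "a \<in> underS r d" for a d
  proof
    assume "y a \<in> U d"
    moreover have "openin X (U d)" using U d by (auto simp: A'_def)
    ultimately obtain F where F: "finite F" "F \<subseteq> C a" "p F \<in> U d"
      using y[OF a, of "{}"] unfolding in_closure_of by auto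
    have "under r a \<subseteq> underS r d"
      using ad r.TRANS r.ANTISYM
      by (auto simp: under_def underS_def dest: transD antisymD)
    then show False
      using pU[of d F] F d by (auto simp: C_def A'_def)
  qed
  let ?r = "Restr r A'"
  have FR: "Field ?r = A'"
    using A by (intro Refl_Field_Restr2[OF r.REFL]) (auto simp: A'_def)
  have "free_sequence X ?r y"
    unfolding free_sequence_def FR
  proof (intro conjI ballI)
    show "well_order_on A' ?r" using Well_order_Restr[OF r, of A'] unfolding FR .
    show "y ` A' \<subseteq> topspace X" using yX by auto
    \<comment> \<open>The set \<open>U d\<close> separates the two closures: the earlier points lie
      in its closed complement, the others in the closure of \<open>V d\<close>, which is inside
      \<open>U d\<close>.\<close>
    fix d assume d: "d \<in> A'"
    then have dA: "d \<in> A" by (simp add: A'_def)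
    have "X closure_of (y ` underS ?r d) \<subseteq> X closure_of (topspace X - U d)"
      using d y_out yX by (intro closure_of_mono) (auto simp: underS_def)
    also have "\<dots> = topspace X - U d"
      using U[OF dA] by (simp add: closure_of_closedin closedin_diff)
    finally have 1: "X closure_of (y ` underS ?r d) \<subseteq> topspace X - U d" .
    have "X closure_of (y ` above ?r d) \<subseteq> X closure_of (V d)"
      using d y_in by (intro closure_of_minimal) (auto simp: above_def)
    then show "X closure_of (y ` underS ?r d) \<inter> X closure_of (y ` above ?r d) = {}"
      using 1 V[OF dA] by blast
  qed
  \<comment> \<open>The hypothesis speaks of index orders on points only; injectivity of
    \<open>y\<close> carries countability back to \<open>A'\<close>.\<close>
  moreover from free_sequence_reindex[OF this] obtain r' :: "'a rel"
    where "Field r' = y ` A'" "free_sequence X r' id"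
    unfolding FR by blast
  moreover from this(2) have "countable (Field r')"
    using nf unfolding no_uncountable_free_sequences_def by blast
  ultimately show False
    using A'_unc free_sequence_inj_on[of X ?r y] by (simp add: FR countable_image_inj_eq)
qed

lemma local_pi_base_subsets:
  assumes "local_pi_base X p \<R>" "openin X W" "p \<in> W"
  shows "local_pi_base X p {R\<in>\<R>. R \<subseteq> W}"
  unfolding local_pi_base_def
proof (intro conjI allI impI)
  fix U assume "openin X U \<and> p \<in> U"
  then have "openin X (U \<inter> W)" "p \<in> U \<inter> W" using assms by auto
  then show "\<exists>R\<in>{R\<in>\<R>. R \<subseteq> W}. R \<subseteq> U"
    using assms(1) unfolding local_pi_base_def by (metis (lifting) le_inf_iff mem_Collect_eq)
qed (use assms(1) in \<open>auto simp: local_pi_base_def\<close>)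

lemma regular_space_shrink:
  assumes "regular_space X" "openin X U" "U \<noteq> {}"
  shows "\<exists>V. openin X V \<and> V \<noteq> {} \<and> X closure_of V \<subseteq> U"
proof -
  from assms(3) obtain x where "x \<in> U" by blast
  then obtain V K where "openin X V" "closedin X K" "x \<in> V" "V \<subseteq> K" "K \<subseteq> U"
    using assms(1,2) unfolding neighbourhood_base_of_closedin[symmetric] neighbourhood_base_of
    by meson
  then show ?thesis
    using closure_of_minimal[of V K X] by blast
qed

text \<open>The cut made by \<open>wfrec\<close> is harmless, because \<open>P a\<close> is only
  given elements below \<open>a\<close>.\<close>

lemma wf_recursive_set:
  assumes "wf R"
  obtains S where "\<And>a. a \<in> S \<longleftrightarrow> P a {b \<in> S. (b, a) \<in> R}"
proof
  define f where "f = wfrec R (\<lambda>f a. P a {b. f b \<and> (b, a) \<in> R})"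
  have "f a \<longleftrightarrow> P a {b. f b \<and> (b, a) \<in> R}" for a
  proof -
    have "{b. cut f R a b \<and> (b, a) \<in> R} = {b. f b \<and> (b, a) \<in> R}"
      by (auto simp: cut_def)
    then show ?thesis
      using wfrec[OF assms, of "\<lambda>f a. P a {b. f b \<and> (b, a) \<in> R}" a, folded f_def] by simp
  qed
  then show "a \<in> {b. f b} \<longleftrightarrow> P a {b \<in> {b. f b}. (b, a) \<in> R}" for a
    unfolding mem_Collect_eq .
qed

theorem corollary2p7:
  fixes X :: "'a topology"
  assumes "regular_space X" and "t1_space X"
    and "countably_compact_space X"
    and "countable_pi_character X"
    and "no_uncountable_free_sequences X"
  shows "\<exists>\<R>. pi_base X \<R> \<and> point_countable_in X \<R>"
proof -
  define Op where "Op = {U. openin X U \<and> U \<noteq> {}}"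
  obtain V where V: "\<And>U. U \<in> Op \<Longrightarrow> openin X (V U) \<and> V U \<noteq> {} \<and> X closure_of V U \<subseteq> U"
  proof -
    have "\<forall>U\<in>Op. \<exists>V. openin X V \<and> V \<noteq> {} \<and> X closure_of V \<subseteq> U"
      using regular_space_shrink[OF assms(1)] by (simp add: Op_def)
    from bchoice[OF this] show thesis using that by blast
  qed
  \<comment> \<open>The factor \<open>topspace X\<close> matters for empty \<open>F\<close>, where
    the intersection alone would be the whole type.\<close>
  define VF where "VF F = topspace X \<inter> \<Inter>(V ` F)" for F
  define good where "good F \<longleftrightarrow> finite F \<and> F \<subseteq> Op \<and> VF F \<noteq> {}" for F
  have VF_open: "openin X (VF F)" if "good F" for F
    unfolding VF_def using that V
    by (cases "F = {}") (auto simp: good_def intro!: openin_Int openin_Inter)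
  have "\<exists>p B. p \<in> VF F \<and> countable B \<and> local_pi_base X p B \<and> (\<forall>R\<in>B. R \<subseteq> VF F)"
    if g: "good F" for F
  proof -
    obtain p where p: "p \<in> VF F" using g by (auto simp: good_def)
    then have "p \<in> topspace X" by (simp add: VF_def)
    then obtain \<R> where "countable \<R>" "local_pi_base X p \<R>"
      using assms(4) unfolding countable_pi_character_def by blast
    then have "countable {R\<in>\<R>. R \<subseteq> VF F}" "local_pi_base X p {R\<in>\<R>. R \<subseteq> VF F}"
      using local_pi_base_subsets[OF _ VF_open[OF g] p] by auto
    then show ?thesis using p by blast
  qed
  then obtain p B where p: "\<And>F. good F \<Longrightarrow> p F \<in> VF F"
    and B_countable: "\<And>F. good F \<Longrightarrow> countable (B F)"
    and B: "\<And>F. good F \<Longrightarrow> local_pi_base X (p F) (B F)"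
    and B_subset: "\<And>F R. good F \<Longrightarrow> R \<in> B F \<Longrightarrow> R \<subseteq> VF F"
    by metis
  obtain r :: "'a set rel" where r: "well_order_on UNIV r"
    using well_order_on by metis
  then have wf: "wf (r - Id)" by (simp add: well_order_on_def)
  obtain S where S: "\<And>U. U \<in> S \<longleftrightarrow> U \<in> Op \<and>
      (\<forall>F. good F \<longrightarrow> F \<subseteq> {W\<in>S. (W, U) \<in> r - Id} \<longrightarrow> (\<forall>R\<in>B F. \<not> R \<subseteq> U))"
    using wf_recursive_set[OF wf, of "\<lambda>U T. U \<in> Op \<and>
      (\<forall>F. good F \<longrightarrow> F \<subseteq> T \<longrightarrow> (\<forall>R\<in>B F. \<not> R \<subseteq> U))"] by blast
  then have S_Op: "S \<subseteq> Op" by blast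
  define \<R> where "\<R> = (\<Union>F\<in>{F. good F \<and> F \<subseteq> S}. B F)"
  have "pi_base X \<R>"
    unfolding pi_base_def
  proof (intro conjI allI impI)
    show "\<forall>R\<in>\<R>. openin X R \<and> R \<noteq> {}"
      using B by (auto simp: \<R>_def local_pi_base_def)
    fix U assume "openin X U \<and> U \<noteq> {}"
    then have U: "U \<in> Op" by (simp add: Op_def)
    show "\<exists>R\<in>\<R>. R \<subseteq> U"
    \<comment> \<open>A selected \<open>U\<close> contains a member of \<open>B {U}\<close>, since
      \<open>p {U}\<close> lies in \<open>V U\<close>; a rejected one was rejected for containing a
      member of some \<open>B F\<close>.\<close>
    proof (cases "U \<in> S")
      case True
      have VU: "V U \<noteq> {}" "V U \<subseteq> topspace X" "V U \<subseteq> U" "openin X (V U)"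
        using V[OF U] closure_of_subset[of "V U" X] openin_subset by blast+
      then have g: "good {U}" using U by (auto simp: good_def VF_def)
      have "p {U} \<in> V U" using p[OF g] by (simp add: VF_def)
      then obtain R where "R \<in> B {U}" "R \<subseteq> V U"
        using B[OF g] VU(4) unfolding local_pi_base_def by blast
      then show ?thesis using True g VU(3) by (auto simp: \<R>_def)
    next
      case False
      then show ?thesis using S[of U] U by (auto simp: \<R>_def)
    qed
  qed
  moreover have "point_countable_in X \<R>"
    unfolding point_countable_in_def
  proof
    fix x assume x: "x \<in> topspace X"
    define A where "A = {U\<in>S. x \<in> V U}"
    have AOp: "A \<subseteq> Op" using S_Op by (auto simp: A_def)
    have g: "good F" if "finite F" "F \<subseteq> A" for F
      using that x AOp by (auto simp: good_def VF_def A_def)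
    have "countable A"
    proof (rule countable_if_no_uncountable_free_sequences[OF assms(3,5),
          where r = r and U = id and V = V and p = p])
      show "Well_order r" "A \<subseteq> Field r"
        using well_order_on_Well_order[OF r] by auto
      show "openin X (id U)" "X closure_of V U \<subseteq> id U" if "U \<in> A" for U
        using that AOp V by (auto simp: Op_def)
      show "p F \<in> topspace X \<inter> \<Inter>(V ` F)" if "finite F" "F \<subseteq> A" for F
        using p[OF g[OF that]] by (simp add: VF_def)
      show "p F \<notin> id U" if U: "U \<in> A" and F: "finite F" "F \<subseteq> A \<inter> underS r U" for U F
      proof
        \<comment> \<open>Then \<open>U\<close> contains a member of \<open>B F\<close>, although
          \<open>F\<close> consists of sets selected before \<open>U\<close>.\<close>
        assume "p F \<in> id U"
        moreover have gF: "good F" using g F by blast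
        moreover have "openin X U" using U AOp by (auto simp: Op_def)
        ultimately obtain R where R: "R \<in> B F" "R \<subseteq> U"
          using B[OF gF] by (auto simp: local_pi_base_def)
        have "F \<subseteq> {W\<in>S. (W, U) \<in> r - Id}"
          using F(2) by (auto simp: underS_def A_def)
        then show False using S[of U] U gF R by (auto simp: A_def)
      qed
    qed
    then have "countable (\<Union>F\<in>{F. finite F \<and> F \<subseteq> A}. B F)"
      using B_countable g by (intro countable_UN countable_Collect_finite_subset) auto
    \<comment> \<open>Members of \<open>B F\<close> are subsets of \<open>VF F\<close>, so one that
      contains \<open>x\<close> forces \<open>x\<close> into \<open>V U\<close> for all
      \<open>U\<close> in \<open>F\<close>.\<close>
    moreover have "{R\<in>\<R>. x \<in> R} \<subseteq> (\<Union>F\<in>{F. finite F \<and> F \<subseteq> A}. B F)"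
    proof
      fix R assume "R \<in> {R\<in>\<R>. x \<in> R}"
      then obtain F where F: "good F" "F \<subseteq> S" "R \<in> B F" "x \<in> R"
        by (auto simp: \<R>_def)
      then have "x \<in> VF F" using B_subset by blast
      then have "F \<subseteq> A" using F(2) by (auto simp: A_def VF_def)
      then show "R \<in> (\<Union>F\<in>{F. finite F \<and> F \<subseteq> A}. B F)"
        using F by (auto simp: good_def)
    qed
    ultimately show "countable {R\<in>\<R>. x \<in> R}"
      by (rule countable_subset[rotated])
  qed
  ultimately show ?thesis by blast
qed

end
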